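(* Let $N\geq1$, $g>0$, $\gamma_1,\dots,\gamma_N>0$ with $\sum_{i=1}^N\gamma_i=1$, $\boldsymbol{H}_N=(H_1,\dots,H_N)^T\in\mathbb{R}^N$ with $H_i>0$ for all $i$, and $\tilde{\boldsymbol{U}}_N=(\tilde u_1,\dots,\tilde u_N)^T\in\mathbb{R}^N$. Then the $2N\times2N$ block matrix $$A_N=\begin{pmatrix}\mathrm{diag}(\tilde{\boldsymbol{U}}_N)&\mathrm{diag}(\boldsymbol{H}_N)\\ g\,\mathbf{1}_N\otimes\boldsymbol{\gamma}_N&\mathrm{diag}(\tilde{\boldsymbol{U}}_N)\end{pmatrix}$$ admits at most $2N$ eigenvalues, given by $$\sigma(A_N)=\left\{c\in\mathbb{C}\setminus\tilde{\boldsymbol{U}}_N:\sum_{i=1}^N\frac{g\gamma_iH_i}{(\tilde u_i-c)^2}=1\right\}\cup\left\{c\in\tilde{\boldsymbol{U}}_N:\mathrm{card}\bigl(\tilde{\boldsymbol{U}}_N^{-1}(c)\bigr)>1\right\},$$ where $\tilde{\boldsymbol{U}}_N^{-1}(c)=\{j\in\{1,\dots,N\}:\tilde u_j=c\}$. In particular, if all the $\tilde u_i$, $i\in\{1,\dots,N\}$, are distinct, then the second set in the union is empty.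
   Context: $\mathbf{1}_N=(1,\dots,1)^T\in\mathbb{R}^N$, $\boldsymbol{\gamma}_N=(\gamma_1,\dots,\gamma_N)^T$, and $\mathbf{1}_N\otimes\boldsymbol{\gamma}_N$ is the $N\times N$ matrix with entries $(\mathbf{1}_N\otimes\boldsymbol{\gamma}_N)_{ij}=\gamma_j$. When $\tilde{\boldsymbol{U}}_N$ is used as a set it means $\{\tilde u_1,\dots,\tilde u_N\}$. In the paper $(\boldsymbol{H}_N,\tilde{\boldsymbol{U}}_N)$ is the value at a point $(t,x)$ of a solution of the multilayer system $\partial_t\tilde{\boldsymbol{\mathcal U}}+A_N(\tilde{\boldsymbol{\mathcal U}})\partial_x\tilde{\boldsymbol{\mathcal U}}=0$, $\tilde{\boldsymbol{\mathcal U}}=(\boldsymbol{H}_N,\tilde{\boldsymbol{U}}_N)^T$ (flat topography), and the statement is pointwise in $(t,x)$. *)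

theory Defs
  imports "Jordan_Normal_Form.Spectral_Radius"
begin

definition diag_of_vec :: "'a :: zero vec \<Rightarrow> 'a mat" where
  "diag_of_vec v = mat_diag (dim_vec v) (\<lambda>i. v $ i)"

definition ones_vec :: "nat \<Rightarrow> 'a :: one vec" where
  "ones_vec n = vec n (\<lambda>_. 1)"

definition outer_prod :: "'a :: times vec \<Rightarrow> 'a vec \<Rightarrow> 'a mat" where
  "outer_prod v w = mat (dim_vec v) (dim_vec w) (\<lambda>(i, j). v $ i * w $ j)"

text \<open>The matrix of the multilayer system with flat topography; the layers, numbered
  from 1 to \<open>N\<close> in the mathematical text, are the vector indices from 0 to \<open>N - 1\<close>.\<close>

definition multilayer_mat :: "real \<Rightarrow> real vec \<Rightarrow> real vec \<Rightarrow> real vec \<Rightarrow> real mat" where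
  "multilayer_mat g \<gamma> H U =
     four_block_mat
       (diag_of_vec U)                                  (diag_of_vec H)
       (g \<cdot>\<^sub>m outer_prod (ones_vec (dim_vec \<gamma>)) \<gamma>)      (diag_of_vec U)"

definition vec_fibre :: "'a vec \<Rightarrow> 'a \<Rightarrow> nat set" where
  "vec_fibre v c = {j \<in> {..<dim_vec v}. v $ j = c}"

end

theory Submission
  imports Defs
begin

text \<open>Writing an eigenvector as \<open>(x, y)\<close> and putting \<open>s = g \<Sum>\<^sub>j \<gamma>\<^sub>j x\<^sub>j\<close>, the eigenvalue
  equations read \<open>(U\<^sub>i - c) x\<^sub>i = - H\<^sub>i y\<^sub>i\<close> and \<open>(U\<^sub>i - c) y\<^sub>i = - s\<close>. If \<open>c\<close> is no velocity, \<open>x\<close> and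
  \<open>y\<close> are determined by \<open>s \<noteq> 0\<close>, and inserting \<open>x\<close> into the definition of \<open>s\<close> gives the secular
  equation. If \<open>c\<close> is a velocity, then \<open>s = 0\<close> and \<open>y = 0\<close>, so that \<open>x\<close> is supported on the
  fibre of \<open>c\<close> and orthogonal to \<open>\<gamma>\<close>; such an \<open>x \<noteq> 0\<close> exists iff the fibre has at least two
  elements, as all \<open>\<gamma>\<^sub>j\<close> are nonzero.\<close>

lemma multilayer_mat_carrier:
  assumes "\<gamma> \<in> carrier_vec N" "H \<in> carrier_vec N" "U \<in> carrier_vec N"
  shows "multilayer_mat g \<gamma> H U \<in> carrier_mat (2 * N) (2 * N)"
  using assms by (auto simp: multilayer_mat_def diag_of_vec_def mult_2)

text \<open>All rows of the lower left block are equal to \<open>g\<close> times the transpose of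
  \<gamma>, so this block has rank at most one and adds the same scalar to every entry of the lower
  half.\<close>

lemma map_multilayer_mat_mult_append:
  fixes g :: real and \<gamma> H U :: "real vec" and x y :: "complex vec"
  assumes [simp]: "\<gamma> \<in> carrier_vec N" "H \<in> carrier_vec N" "U \<in> carrier_vec N"
    and [simp]: "x \<in> carrier_vec N" "y \<in> carrier_vec N"
  shows "map_mat complex_of_real (multilayer_mat g \<gamma> H U) *\<^sub>v (x @\<^sub>v y) =
    vec N (\<lambda>i. of_real (U $ i) * x $ i + of_real (H $ i) * y $ i) @\<^sub>v
    vec N (\<lambda>i. of_real g * (\<Sum>j<N. of_real (\<gamma> $ j) * x $ j) + of_real (U $ i) * y $ i)"
proof -
  have dims [simp]: "dim_vec \<gamma> = N" "dim_vec H = N" "dim_vec U = N" "dim_vec x = N" "dim_vec y = N"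
    using assms by auto
  let ?D = "\<lambda>v. map_mat complex_of_real (diag_of_vec v)"
  let ?R = "map_mat complex_of_real (g \<cdot>\<^sub>m outer_prod (ones_vec N) \<gamma>)"
  have D_carrier: "?D v \<in> carrier_mat N N" if "v \<in> carrier_vec N" for v
    using that by (auto simp: diag_of_vec_def)
  have R_carrier: "?R \<in> carrier_mat N N"
    by (simp add: outer_prod_def ones_vec_def)
  have D_mult: "?D v *\<^sub>v z = vec N (\<lambda>i. of_real (v $ i) * z $ i)"
    if "v \<in> carrier_vec N" "z \<in> carrier_vec N" for v z
    using that
    by (intro eq_vecI) (auto simp: diag_of_vec_def mat_diag_def scalar_prod_def if_distrib[of complex_of_real]
        if_distrib[of "\<lambda>a. a * _"] sum.delta cong: if_cong)
  have R_mult: "?R *\<^sub>v x = vec N (\<lambda>i. of_real g * (\<Sum>j<N. of_real (\<gamma> $ j) * x $ j))"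
    by (intro eq_vecI)
      (auto simp: outer_prod_def ones_vec_def scalar_prod_def sum_distrib_left mult.assoc lessThan_atLeast0)
  have "map_mat complex_of_real (multilayer_mat g \<gamma> H U) = four_block_mat (?D U) (?D H) ?R (?D U)"
    unfolding multilayer_mat_def dims
    by (rule map_four_block_mat[of _ N N _ N _ N])
      (auto simp: diag_of_vec_def outer_prod_def ones_vec_def)
  also have "\<dots> *\<^sub>v (x @\<^sub>v y) = (?D U *\<^sub>v x + ?D H *\<^sub>v y) @\<^sub>v (?R *\<^sub>v x + ?D U *\<^sub>v y)"
    by (intro four_block_mat_mult_vec[of _ N N _ N _ N] D_carrier R_carrier) simp_all
  also have "?D U *\<^sub>v x + ?D H *\<^sub>v y = vec N (\<lambda>i. of_real (U $ i) * x $ i + of_real (H $ i) * y $ i)"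
    by (auto simp: D_mult)
  also have "?R *\<^sub>v x + ?D U *\<^sub>v y =
      vec N (\<lambda>i. of_real g * (\<Sum>j<N. of_real (\<gamma> $ j) * x $ j) + of_real (U $ i) * y $ i)"
    by (auto simp: D_mult R_mult)
  finally show ?thesis .
qed

text \<open>Bridge from matrices to scalar equations: an eigenvector is cut into two halves of
  length \<open>N\<close>. The halves are taken as functions on the naturals, constrained only below
  \<open>N\<close>, so that what remains is algebra over a field.\<close>

lemma spectrum_multilayer_mat_iff:
  fixes g :: real and \<gamma> H U :: "real vec"
  assumes [simp]: "\<gamma> \<in> carrier_vec N" "H \<in> carrier_vec N" "U \<in> carrier_vec N"
  shows "c \<in> spectrum (map_mat complex_of_real (multilayer_mat g \<gamma> H U)) \<longleftrightarrow>
    (\<exists>x y. (\<exists>i<N. x i \<noteq> 0 \<or> y i \<noteq> 0) \<and>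
      (\<forall>i<N. of_real (U $ i) * x i + of_real (H $ i) * y i = c * x i \<and>
             of_real g * (\<Sum>j<N. of_real (\<gamma> $ j) * x j) + of_real (U $ i) * y i = c * y i))"
    (is "_ \<longleftrightarrow> (\<exists>x y. ?P x y)")
proof -
  let ?A = "map_mat complex_of_real (multilayer_mat g \<gamma> H U)"
  have dim: "dim_row ?A = 2 * N"
    using multilayer_mat_carrier[OF assms, of g] by auto
  have eq: "eigenvector ?A (x @\<^sub>v y) c \<longleftrightarrow> ?P (($) x) (($) y)"
    if xy [simp]: "x \<in> carrier_vec N" "y \<in> carrier_vec N" for x y
  proof -
    have [simp]: "dim_vec x = N" "dim_vec y = N" using xy by auto
    have "0\<^sub>v (2 * N) = 0\<^sub>v N @\<^sub>v (0\<^sub>v N :: complex vec)"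
      by (auto simp: mult_2)
    hence "x @\<^sub>v y = 0\<^sub>v (2 * N) \<longleftrightarrow> x = 0\<^sub>v N \<and> y = 0\<^sub>v N"
      by (simp only:) (rule append_vec_eq[of _ N], simp_all)
    hence "x @\<^sub>v y \<noteq> 0\<^sub>v (2 * N) \<longleftrightarrow> (\<exists>i<N. x $ i \<noteq> 0 \<or> y $ i \<noteq> 0)"
      by (auto simp: vec_eq_iff)
    moreover have "c \<cdot>\<^sub>v (x @\<^sub>v y) = (c \<cdot>\<^sub>v x) @\<^sub>v (c \<cdot>\<^sub>v y)"
      by (auto simp: append_vec_def)
    moreover have "vec N a @\<^sub>v vec N b = (c \<cdot>\<^sub>v x) @\<^sub>v (c \<cdot>\<^sub>v y) \<longleftrightarrow>
        (\<forall>i<N. a i = c * x $ i \<and> b i = c * y $ i)" for a b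
      by (subst append_vec_eq[of _ N]) (auto simp: vec_eq_iff)
    ultimately show ?thesis
      unfolding eigenvector_def dim map_multilayer_mat_mult_append[OF assms xy]
      by (simp add: mult_2)
  qed
  show ?thesis
  proof
    assume "c \<in> spectrum ?A"
    then obtain v where v: "eigenvector ?A v c"
      by (auto simp: spectrum_def eigenvalue_def)
    hence "v \<in> carrier_vec (N + N)"
      using dim by (auto simp: eigenvector_def mult_2)
    \<comment> \<open>Every vector of length \<open>N + N\<close> is the concatenation of its
      halves, so \<open>eq\<close> applies to an arbitrary eigenvector.\<close>
    then have "vec_first v N @\<^sub>v vec_last v N = v" by simp
    with v have "?P (($) (vec_first v N)) (($) (vec_last v N))"
      by (subst eq[symmetric]) auto
    thus "\<exists>x y. ?P x y" by blast
  next
    assume "\<exists>x y. ?P x y"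
    then obtain x y where "?P x y" by blast
    hence "eigenvector ?A (vec N x @\<^sub>v vec N y) c"
      by (subst eq) auto
    thus "c \<in> spectrum ?A"
      by (auto simp: spectrum_def eigenvalue_def)
  qed
qed

text \<open>All factors \<open>U i - c\<close> are invertible, so a solution is determined by the
  single scalar \<open>s\<close>; the secular equation is the consistency condition for a nonzero
  \<open>s\<close>.\<close>

lemma multilayer_system_off_velocities:
  fixes g c :: "'a :: field" and \<gamma> H U :: "nat \<Rightarrow> 'a"
  assumes c: "\<And>i. i < N \<Longrightarrow> U i \<noteq> c"
  shows "(\<exists>x y. (\<exists>i<N. x i \<noteq> 0 \<or> y i \<noteq> 0) \<and>
      (\<forall>i<N. U i * x i + H i * y i = c * x i \<and> g * (\<Sum>j<N. \<gamma> j * x j) + U i * y i = c * y i)) \<longleftrightarrow>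
    (\<Sum>i<N. g * \<gamma> i * H i / (U i - c)\<^sup>2) = 1"
    (is "?L \<longleftrightarrow> ?R")
proof
  assume ?L
  then obtain x y where nz: "\<exists>i<N. x i \<noteq> 0 \<or> y i \<noteq> 0"
    and e: "\<And>i. i < N \<Longrightarrow> U i * x i + H i * y i = c * x i"
           "\<And>i. i < N \<Longrightarrow> g * (\<Sum>j<N. \<gamma> j * x j) + U i * y i = c * y i" by blast
  define s where "s = g * (\<Sum>j<N. \<gamma> j * x j)"
  have y: "y i = - s / (U i - c)" if "i < N" for i
  proof -
    have "(U i - c) * y i = - s"
      by (simp add: left_diff_distrib e(2)[OF that, symmetric] s_def)
    thus ?thesis
      using c[OF that] by (subst nonzero_eq_divide_eq) (simp_all add: mult.commute)
  qed
  have x: "x i = H i * s / (U i - c)\<^sup>2" if "i < N" for i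
  proof -
    have "(U i - c) * x i = - H i * y i"
      by (simp add: left_diff_distrib e(1)[OF that, symmetric])
    hence "(U i - c) * x i = H i * s / (U i - c)"
      by (simp add: y[OF that])
    hence "x i = H i * s / (U i - c) / (U i - c)"
      using c[OF that] by (simp add: nonzero_eq_divide_eq mult_ac)
    thus ?thesis
      by (simp add: power2_eq_square)
  qed
  \<comment> \<open>If \<open>s\<close> were zero, the formulas for \<open>x\<close> and
    \<open>y\<close> would make both vanish below \<open>N\<close>.\<close>
  have "s \<noteq> 0" using nz x y by auto
  have "s = g * (\<Sum>j<N. \<gamma> j * x j)" by (fact s_def)
  also have "\<dots> = (\<Sum>i<N. g * \<gamma> i * H i / (U i - c)\<^sup>2) * s"
    unfolding sum_distrib_left sum_distrib_right
    by (intro sum.cong refl) (simp add: x mult_ac)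
  finally have "s = (\<Sum>i<N. g * \<gamma> i * H i / (U i - c)\<^sup>2) * s" .
  with \<open>s \<noteq> 0\<close> show ?R by (simp only: mult_cancel_right1 simp_thms)
next
  assume R: ?R
  \<comment> \<open>The solution normalised to \<open>s = 1\<close>.\<close>
  define x y where "x i = H i / (U i - c)\<^sup>2" and "y i = - 1 / (U i - c)" for i
  have s: "g * (\<Sum>j<N. \<gamma> j * x j) = 1"
    using R by (simp add: x_def sum_distrib_left mult.assoc)
  \<comment> \<open>For \<open>N = 0\<close> the empty sum would have to equal 1. Hence index 0 is
    available, and \<open>y 0\<close> is nonzero.\<close>
  have "N \<noteq> 0" using R by (cases N) auto
  hence "\<exists>i<N. x i \<noteq> 0 \<or> y i \<noteq> 0"
    using c by (intro exI[of _ 0]) (auto simp: y_def)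
  moreover have "U i * x i + H i * y i = c * x i" "g * (\<Sum>j<N. \<gamma> j * x j) + U i * y i = c * y i"
    if "i < N" for i
  proof -
    have "U i - c \<noteq> 0" using c[OF that] by simp
    hence "(U i - c) * x i + H i * y i = 0" "1 + (U i - c) * y i = 0"
      by (simp_all add: x_def y_def power2_eq_square)
    thus "U i * x i + H i * y i = c * x i" "g * (\<Sum>j<N. \<gamma> j * x j) + U i * y i = c * y i"
      unfolding s by (simp_all add: algebra_simps)
  qed
  ultimately show ?L by blast
qed

text \<open>The solutions are the pairs with \<open>y = 0\<close> and \<open>x\<close> on the fibre
  of \<open>c\<close>, subject to one nontrivial linear condition; a nonzero one needs at least two
  free entries.\<close>

lemma multilayer_system_at_velocity:
  fixes g c :: "'a :: field" and \<gamma> H U :: "nat \<Rightarrow> 'a"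
  assumes g: "g \<noteq> 0" and \<gamma>: "\<And>i. i < N \<Longrightarrow> \<gamma> i \<noteq> 0" and H: "\<And>i. i < N \<Longrightarrow> H i \<noteq> 0"
    and c: "\<exists>i<N. U i = c"
  shows "(\<exists>x y. (\<exists>i<N. x i \<noteq> 0 \<or> y i \<noteq> 0) \<and>
      (\<forall>i<N. U i * x i + H i * y i = c * x i \<and> g * (\<Sum>j<N. \<gamma> j * x j) + U i * y i = c * y i)) \<longleftrightarrow>
    card {j. j < N \<and> U j = c} > 1"
    (is "?L \<longleftrightarrow> ?R")
proof
  assume ?L
  then obtain x y where nz: "\<exists>i<N. x i \<noteq> 0 \<or> y i \<noteq> 0"
    and e: "\<And>i. i < N \<Longrightarrow> U i * x i + H i * y i = c * x i"
           "\<And>i. i < N \<Longrightarrow> g * (\<Sum>j<N. \<gamma> j * x j) + U i * y i = c * y i" by blast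
  \<comment> \<open>At an index with \<open>U i = c\<close> the terms in \<open>y i\<close> cancel
    in the second equation, leaving \<open>g\<close> times the sum equal to zero.\<close>
  have s: "(\<Sum>j<N. \<gamma> j * x j) = 0"
    using c e(2) g by fastforce
  \<comment> \<open>On the fibre the first equation reduces to \<open>H i * y i = 0\<close>; off it
    the second one gives \<open>(U i - c) * y i = 0\<close>.\<close>
  have y: "y i = 0" if "i < N" for i
    using e[OF that] H[OF that] s by (cases "U i = c") auto
  obtain k where k: "k < N" "x k \<noteq> 0" using nz y by blast
  hence Uk: "U k = c" using e(1)[OF k(1)] y by auto
  show ?R
  proof (rule ccontr)
    assume "\<not> ?R"
    hence only: "j = k" if "j < N" "U j = c" for j
      using that k Uk card_le_Suc0_iff_eq[of "{j. j < N \<and> U j = c}"] by auto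
    \<comment> \<open>With \<open>k\<close> the only fibre index, the sum collapses to
      \<open>\<gamma> k * x k\<close>, a product of nonzero factors.\<close>
    have "x j = 0" if "j < N" "j \<noteq> k" for j
      using e(1)[OF that(1)] y[OF that(1)] only that by auto
    hence "(\<Sum>j<N. \<gamma> j * x j) = (\<Sum>j<N. if j = k then \<gamma> k * x k else 0)"
      by (intro sum.cong) auto
    with s k \<gamma> show False by simp
  qed
next
  assume ?R
  hence "\<not> card {j. j < N \<and> U j = c} \<le> Suc 0" by simp
  then obtain k l where kl: "k < N" "l < N" "U k = c" "U l = c" "k \<noteq> l"
    by (subst (asm) card_le_Suc0_iff_eq) auto
  \<comment> \<open>Two fibre entries weighted crosswise, so that their contributions to the sum
    cancel.\<close>
  define x where "x j = (if j = k then \<gamma> l else 0) - (if j = l then \<gamma> k else 0)" for j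
  have "(\<Sum>j<N. \<gamma> j * x j) =
      (\<Sum>j<N. (if j = k then \<gamma> k * \<gamma> l else 0) - (if j = l then \<gamma> l * \<gamma> k else 0))"
    by (intro sum.cong) (auto simp: x_def)
  also have "\<dots> = 0" using kl by (simp add: sum_subtractf)
  finally have "(\<Sum>j<N. \<gamma> j * x j) = 0" .
  moreover have "x k \<noteq> 0" using kl \<gamma> by (simp add: x_def)
  moreover have "U i * x i = c * x i" for i
    using kl by (simp add: x_def)
  ultimately show ?L
    using kl(1) by (intro exI[of _ x] exI[of _ "\<lambda>_. 0"]) auto
qed

theorem proposition5p6:
  fixes N :: nat and g :: real and \<gamma> H U :: "real vec"
  assumes "N \<ge> 1" and "g > 0"
    and "\<gamma> \<in> carrier_vec N" and "\<And>i. i < N \<Longrightarrow> \<gamma> $ i > 0" and "(\<Sum>i<N. \<gamma> $ i) = 1"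
    and "H \<in> carrier_vec N" and "\<And>i. i < N \<Longrightarrow> H $ i > 0"
    and "U \<in> carrier_vec N"
  defines "A \<equiv> map_mat complex_of_real (multilayer_mat g \<gamma> H U)"
    and "Uc \<equiv> map_vec complex_of_real U"
  shows "finite (spectrum A) \<and> card (spectrum A) \<le> 2 * N \<and>
    spectrum A =
      {c. c \<notin> vec_set Uc \<and>
          (\<Sum>i<N. complex_of_real (g * \<gamma> $ i * H $ i) / (complex_of_real (U $ i) - c)\<^sup>2) = 1}
      \<union> {c \<in> vec_set Uc. card (vec_fibre Uc c) > 1} \<and>
    (inj_on (\<lambda>i. U $ i) {..<N} \<longrightarrow>
      {c \<in> vec_set Uc. card (vec_fibre Uc c) > 1} = {})"
proof -
  have carrier: "\<gamma> \<in> carrier_vec N" "H \<in> carrier_vec N" "U \<in> carrier_vec N" by fact+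
  have dim [simp]: "dim_vec U = N" using carrier by auto
  have "A \<in> carrier_mat (2 * N) (2 * N)"
    unfolding A_def using multilayer_mat_carrier[OF carrier] by simp
  \<comment> \<open>The count comes from the size of the matrix alone, independently of the
    description of the spectrum.\<close>
  note bound = card_finite_spectrum[OF this]
  have mem: "c \<in> vec_set Uc \<longleftrightarrow> (\<exists>i<N. complex_of_real (U $ i) = c)" for c
    by (auto simp: Uc_def vec_set_def)
  have fibre: "vec_fibre Uc c = {j. j < N \<and> complex_of_real (U $ j) = c}" for c
    by (auto simp: Uc_def vec_fibre_def)
  have "c \<in> spectrum A \<longleftrightarrow>
      c \<notin> vec_set Uc \<and>
          (\<Sum>i<N. complex_of_real (g * \<gamma> $ i * H $ i) / (complex_of_real (U $ i) - c)\<^sup>2) = 1 \<or>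
      c \<in> vec_set Uc \<and> card (vec_fibre Uc c) > 1" for c
  proof (cases "c \<in> vec_set Uc")
    case True
    moreover have "complex_of_real g \<noteq> 0" "\<And>i. i < N \<Longrightarrow> complex_of_real (\<gamma> $ i) \<noteq> 0"
      "\<And>i. i < N \<Longrightarrow> complex_of_real (H $ i) \<noteq> 0"
      using assms(2,4,7) by force+
    ultimately show ?thesis
      unfolding A_def spectrum_multilayer_mat_iff[OF carrier] fibre
      by (subst multilayer_system_at_velocity) (auto simp: mem)
  next
    case False
    thus ?thesis
      unfolding A_def spectrum_multilayer_mat_iff[OF carrier]
      by (subst multilayer_system_off_velocities) (auto simp: mem)
  qed
  hence "spectrum A =
      {c. c \<notin> vec_set Uc \<and>
          (\<Sum>i<N. complex_of_real (g * \<gamma> $ i * H $ i) / (complex_of_real (U $ i) - c)\<^sup>2) = 1}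
      \<union> {c \<in> vec_set Uc. card (vec_fibre Uc c) > 1}"
    by blast
  \<comment> \<open>The embedding of the reals is injective, so distinct velocities stay distinct in
    the complex numbers.\<close>
  moreover have "card (vec_fibre Uc c) \<le> 1" if "inj_on (\<lambda>i. U $ i) {..<N}" for c
    using that unfolding fibre
    by (auto simp: card_le_Suc0_iff_eq inj_on_def)
  ultimately show ?thesis
    using bound by (auto simp: not_less[symmetric])
qed

end
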